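(* Let $\mu\in(0,1]$ and let $\mathbb{X}\subset\mathbb{R}^{d}$ be a nonempty closed subset with positive $\mu$-reach $\tau^{\mu}>0$. For every real $r$ with $0<r\le\tau^{\mu}$, the $r$-offset $\mathbb{X}^{r}$ deformation retracts to $\mathbb{X}$. In particular, $\mathbb{X}$ and $\mathbb{X}^{r}$ are homotopy equivalent.
   Context: For closed $\mathbb{X}\subset\mathbb{R}^d$, $d_{\mathbb{X}}(x)=\inf_{y\in\mathbb{X}}\|x-y\|$ (Euclidean). For $x\in\mathbb{R}^d\setminus\mathbb{X}$, $\Gamma_{\mathbb{X}}(x)$ is the set of points of $\mathbb{X}$ closest to $x$, $\Theta_{\mathbb{X}}(x)$ is the center of the unique smallest closed ball enclosing $\Gamma_{\mathbb{X}}(x)$, and the generalized gradient is $\nabla_{\mathbb{X}}(x)=\frac{x-\Theta_{\mathbb{X}}(x)}{d_{\mathbb{X}}(x)}$. For $\mu\in(0,1]$ the $\mu$-medial axis is $\mathrm{Med}_\mu(\mathbb{X})=\{x\in\mathbb{R}^d\setminus\mathbb{X}:\|\nabla_{\mathbb{X}}(x)\|<\mu\}$, and the $\mu$-reach is $\tau^\mu_{\mathbb{X}}=\inf\{\|q-x\|:q\in\mathbb{X},\ x\in\mathrm{Med}_\mu(\mathbb{X})\}$ ($+\infty$ if $\mathrm{Med}_\mu(\mathbb{X})=\emptyset$). The $r$-offset is $\mathbb{X}^r=\{y\in\mathbb{R}^d:d_{\mathbb{X}}(y)<r\}$, the union of open $r$-balls centered at points of $\mathbb{X}$. A space $X$ deformation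 retracts to $A\subset X$ if there is a continuous $H:X\times[0,1]\to X$ with $H(x,0)=x$ and $H(x,1)\in A$ for all $x\in X$, and $H(x,t)=x$ for all $x\in A$, $t\in[0,1]$. *)

theory Defs
  imports "HOL-Analysis.Analysis"
begin

definition closest_points :: "'a::euclidean_space set \<Rightarrow> 'a \<Rightarrow> 'a set"
  where "closest_points X x = {y \<in> X. dist x y = infdist x X}"

definition is_smallest_enclosing_ball :: "'a::euclidean_space set \<Rightarrow> 'a \<Rightarrow> real \<Rightarrow> bool"
  where "is_smallest_enclosing_ball S c \<rho> \<longleftrightarrow>
    0 \<le> \<rho> \<and> S \<subseteq> cball c \<rho> \<and> (\<forall>c' \<rho>'. 0 \<le> \<rho>' \<and> S \<subseteq> cball c' \<rho>' \<longrightarrow> \<rho> \<le> \<rho>')"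

(* The description is proper whenever S is nonempty and bounded; this covers the sets of
   closest points of a nonempty closed set, the only ones to which it is applied below. *)
definition enclosing_center :: "'a::euclidean_space set \<Rightarrow> 'a"
  where "enclosing_center S = (THE c. \<exists>\<rho>. is_smallest_enclosing_ball S c \<rho>)"

definition gen_gradient :: "'a::euclidean_space set \<Rightarrow> 'a \<Rightarrow> 'a"
  where "gen_gradient X x = (x - enclosing_center (closest_points X x)) /\<^sub>R infdist x X"

definition mu_medial_axis :: "real \<Rightarrow> 'a::euclidean_space set \<Rightarrow> 'a set"
  where "mu_medial_axis \<mu> X = {x. x \<notin> X \<and> norm (gen_gradient X x) < \<mu>}"

(* Extended-real valued, so that the infimum over the empty set is infinity. *)
definition mu_reach :: "real \<Rightarrow> 'a::euclidean_space set \<Rightarrow> ereal"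
  where "mu_reach \<mu> X = Inf {ereal (norm (q - x)) | q x. q \<in> X \<and> x \<in> mu_medial_axis \<mu> X}"

definition offset :: "'a::euclidean_space set \<Rightarrow> real \<Rightarrow> 'a set"
  where "offset X r = {y. infdist y X < r}"

(* The homotopy fixes A pointwise at all times, unlike in the library's lemmas on
   deformation retracts, which only ask for a retraction homotopic to the identity. *)
definition deformation_retracts_to :: "'a::topological_space set \<Rightarrow> 'a set \<Rightarrow> bool"
    (infix \<open>deformation'_retracts'_to\<close> 50)
  where "X deformation_retracts_to A \<longleftrightarrow> A \<subseteq> X \<and>
    (\<exists>H :: 'a \<times> real \<Rightarrow> 'a.
        continuous_on (X \<times> {0..1}) H \<and>
        H ` (X \<times> {0..1}) \<subseteq> X \<and>
        (\<forall>x\<in>X. H (x, 0) = x \<and> H (x, 1) \<in> A) \<and>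
        (\<forall>x\<in>A. \<forall>t\<in>{0..1}. H (x, t) = x))"

end

theory Submission
  imports Defs
begin

text \<open>No flow is integrated. The center of the smallest ball enclosing the closest points of \<open>x\<close>
  is the projection of \<open>x\<close> to their convex hull, so off the medial axis, moving towards it
  decreases the distance to \<open>X\<close> at rate at least \<open>\<mu>\<close>, and near \<open>x\<close> the same direction still gives
  rate \<open>\<mu> / 2\<close>. Cutting this constant direction off near \<open>x\<close> gives an elementary push.
  Countably many pushes suffice to move every point of the offset outside \<open>X\<close>; they are composed
  in a sequence in which each of them occurs infinitely often. Every path so obtained has length at
  most \<open>2 / \<mu>\<close> times the initial distance to \<open>X\<close>, hence converges; its limit is moved by no push and
  therefore lies in \<open>X\<close>. As the remaining length is controlled by the current distance to \<open>X\<close>,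
  the convergence is locally uniform and the limit is continuous.\<close>

section \<open>Descent fields and their countable selection\<close>

text \<open>All fractions \<open>t\<close> of a push are controlled, not only the full push, because
  the time parameter of the homotopy will scale each push. Measuring the drop of \<open>f\<close>
  against the length moved is what later bounds path lengths.\<close>

definition descent_field :: "('a::real_normed_vector \<Rightarrow> real) \<Rightarrow> real \<Rightarrow> ('a \<Rightarrow> 'a) \<Rightarrow> bool"
  where "descent_field f c u \<longleftrightarrow> continuous_on UNIV u \<and>
    (\<forall>z. \<forall>t\<in>{0..1}. f (z + t *\<^sub>R u z) \<le> f z - c * (t * norm (u z)))"

text \<open>The sets where the fields do not vanish are open, so by Lindelof countably many of them
  cover \<open>W\<close>. The same field \<open>v\<close> recurs at arbitrarily late indices, so
  that its continuity can be used along a subsequence.\<close>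

lemma descent_field_sequence:
  fixes f :: "'a::{real_normed_vector, second_countable_topology} \<Rightarrow> real"
  assumes "\<And>x. x \<in> W \<Longrightarrow> \<exists>u. descent_field f c u \<and> u x \<noteq> 0"
  obtains U :: "nat \<Rightarrow> 'a \<Rightarrow> 'a" where "\<forall>n. descent_field f c (U n)"
    and "\<forall>x\<in>W. \<exists>v. v x \<noteq> 0 \<and> (\<forall>k. \<exists>n\<ge>k. U n = v)"
proof -
  define \<F> where "\<F> = {{z. u z \<noteq> 0} | u. descent_field f c u}"
  have "open S" if "S \<in> \<F>" for S
  proof -
    obtain u where u: "S = {z. u z \<noteq> 0}" "descent_field f c u"
      using \<open>S \<in> \<F>\<close> unfolding \<F>_def by blast
    then show ?thesis
      by (auto simp: descent_field_def intro!: open_Collect_neq continuous_intros)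
  qed
  then obtain \<G> where \<G>: "\<G> \<subseteq> \<F>" "countable \<G>" "\<Union>\<G> = \<Union>\<F>"
    by (rule Lindelof)
  \<comment> \<open>The zero field contributes the empty set to \<open>\<F>\<close>. The enumeration
    of \<open>insert {} \<G>\<close> then makes sense even when \<open>\<G>\<close> is
    empty.\<close>
  have "descent_field f c (\<lambda>_. 0)"
    by (simp add: descent_field_def)
  then have "{} \<in> \<F>"
    unfolding \<F>_def by force
  then have "\<forall>S\<in>insert {} \<G>. \<exists>u. descent_field f c u \<and> S = {z. u z \<noteq> 0}"
    using \<G>(1) unfolding \<F>_def by blast
  then obtain u where u: "\<And>S. S \<in> insert {} \<G> \<Longrightarrow> descent_field f c (u S) \<and> S = {z. u S z \<noteq> 0}"
    by metis
  define e where "e = from_nat_into (insert {} \<G>)"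
  have e_in: "e i \<in> insert {} \<G>" for i
    unfolding e_def by (rule from_nat_into) auto
  \<comment> \<open>The second component of the decoded pair is ignored: the field of index
    \<open>i\<close> recurs at every \<open>prod_encode (i, k)\<close>, which is at least
    \<open>k\<close>.\<close>
  define U where "U n = u (e (fst (prod_decode n)))" for n
  show ?thesis
  proof
    show "\<forall>n. descent_field f c (U n)"
      using u e_in unfolding U_def by blast
    show "\<forall>x\<in>W. \<exists>v. v x \<noteq> 0 \<and> (\<forall>k. \<exists>n\<ge>k. U n = v)"
    proof
      fix x assume "x \<in> W"
      then have "x \<in> \<Union>\<F>"
        using assms[of x] unfolding \<F>_def by blast
      then obtain S where S: "S \<in> \<G>" "x \<in> S"
        using \<G>(3) by blast
      obtain m where m: "e m = S"
        using from_nat_into_surj[of "insert {} \<G>" S] \<G>(2) S(1) unfolding e_def by auto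
      have "U (prod_encode (m, k)) = u S" for k
        by (simp add: U_def m)
      moreover have "u S x \<noteq> 0"
        using u[of S] S by blast
      ultimately show "\<exists>v. v x \<noteq> 0 \<and> (\<forall>k. \<exists>n\<ge>k. U n = v)"
        using le_prod_encode_2 by blast
    qed
  qed
qed

section \<open>The limit of infinitely many pushes\<close>

lemma deformation_retracts_to_zero_set:
  fixes f :: "'a::euclidean_space \<Rightarrow> real"
  assumes cont_f: "continuous_on UNIV f" and f_nonneg: "\<And>z. 0 \<le> f z"
    and "0 < c" and "0 < r"
    and descent: "\<And>x. 0 < f x \<Longrightarrow> f x < r \<Longrightarrow> \<exists>u. descent_field f c u \<and> u x \<noteq> 0"
  shows "{z. f z < r} deformation_retracts_to {z. f z = 0}"
proof -
  define W where "W = {x. 0 < f x \<and> f x < r}"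
  have ex: "\<exists>u. descent_field f c u \<and> u x \<noteq> 0" if "x \<in> W" for x
    using descent that by (simp add: W_def)
  obtain U :: "nat \<Rightarrow> 'a \<Rightarrow> 'a" where U: "\<forall>n. descent_field f c (U n)"
    and U_rec: "\<forall>x\<in>W. \<exists>v. v x \<noteq> 0 \<and> (\<forall>k. \<exists>n\<ge>k. U n = v)"
    by (rule descent_field_sequence[of W f c, OF ex])
  have U_cont: "continuous_on UNIV (U n)"
    and U_desc: "t \<in> {0..1} \<Longrightarrow> f (z + t *\<^sub>R U n z) \<le> f z - c * (t * norm (U n z))" for n z t
    using U unfolding descent_field_def by blast+
  text \<open>For \<open>t < 1\<close> only finitely many of the weights \<open>a n t\<close> are nonzero, while \<open>a n 1 = 1\<close> for all \<open>n\<close>.\<close>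
  define a where "a n t = max 0 (1 - real (Suc n) * (1 - t))" for n t
  have a_range: "a n t \<in> {0..1}" if "t \<in> {0..1}" for n t
    using that by (auto simp: a_def)
  define F where "F = rec_nat (fst :: 'a \<times> real \<Rightarrow> 'a) (\<lambda>n G p. G p + a n (snd p) *\<^sub>R U n (G p))"
  have F_0: "F 0 p = fst p" and F_Suc: "F (Suc n) p = F n p + a n (snd p) *\<^sub>R U n (F n p)" for n p
    by (simp_all add: F_def)
  define P where "P = {z. f z < r} \<times> {0..1::real}"

  have F_cont: "continuous_on P (F n)" for n
  proof (induction n)
    case 0
    then show ?case
      by (auto simp: F_0 [abs_def] intro: continuous_intros)
  next
    case (Suc n)
    have "continuous_on P (\<lambda>p. U n (F n p))"
      by (rule continuous_on_compose2[OF U_cont Suc]) auto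
    with Suc show ?case
      unfolding F_Suc [abs_def] a_def by (intro continuous_intros)
  qed
  have step: "f (F (Suc n) p) \<le> f (F n p) - c * dist (F n p) (F (Suc n) p)" if "p \<in> P" for n p
  proof -
    have "a n (snd p) \<in> {0..1}"
      using a_range that by (auto simp: P_def)
    with U_desc[OF this, of "F n p" n] show ?thesis
      by (simp add: F_Suc dist_norm)
  qed
  \<comment> \<open>Telescoping \<open>step\<close> bounds the distance travelled between two stages
    by the drop of \<open>f\<close>. As \<open>f\<close> is nonnegative, the drops are summable,
    which makes the iterates Cauchy.\<close>
  have path_length: "c * dist (F n p) (F (n + k) p) \<le> f (F n p) - f (F (n + k) p)" if "p \<in> P" for n k p
  proof (induction k)
    case (Suc k)
    have "c * dist (F n p) (F (n + Suc k) p)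
        \<le> c * (dist (F n p) (F (n + k) p) + dist (F (n + k) p) (F (Suc (n + k)) p))"
      using \<open>0 < c\<close> dist_triangle[of "F n p" "F (n + Suc k) p" "F (n + k) p"] by simp
    with Suc step[OF that, of "n + k"] show ?case
      by (simp add: algebra_simps)
  qed simp
  have f_antimono: "f (F (n + k) p) \<le> f (F n p)" if "p \<in> P" for n k p
    using path_length[OF that, of n k] \<open>0 < c\<close>
    by (smt (verit) zero_le_dist mult_nonneg_nonneg)
  have F_Cauchy: "Cauchy (\<lambda>n. F n p)" if "p \<in> P" for p
  proof -
    have "decseq (\<lambda>n. f (F n p))"
      using f_antimono[OF that] by (auto simp: decseq_def dest!: le_Suc_ex)
    then obtain L where "(\<lambda>n. f (F n p)) \<longlonglongrightarrow> L"
      using decseq_convergent[of "\<lambda>n. f (F n p)" 0] f_nonneg by blast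
    then have "Cauchy (\<lambda>n. f (F n p))"
      by (rule LIMSEQ_imp_Cauchy)
    then have *: "\<forall>e>0. \<exists>M. \<forall>m\<ge>M. \<forall>n>m. dist (f (F m p)) (f (F n p)) < e"
      by (simp only: Cauchy_altdef)
    show ?thesis
      unfolding Cauchy_altdef
    proof (rule allI, rule impI)
      fix e :: real assume "0 < e"
      obtain M where M: "\<And>m n. m \<ge> M \<Longrightarrow> n > m \<Longrightarrow> dist (f (F m p)) (f (F n p)) < c * e"
        using * \<open>0 < c\<close> \<open>0 < e\<close> by (meson mult_pos_pos)
      have "dist (F m p) (F n p) < e" if "m \<ge> M" "n > m" for m n
      proof -
        have "c * dist (F m p) (F n p) < c * e"
          using M[OF that] path_length[OF \<open>p \<in> P\<close>, of m "n - m"] that(2)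
          by (simp add: dist_real_def)
        then show ?thesis
          using \<open>0 < c\<close> by simp
      qed
      then show "\<exists>M. \<forall>m\<ge>M. \<forall>n>m. dist (F m p) (F n p) < e"
        by blast
    qed
  qed
  define H where "H p = lim (\<lambda>n. F n p)" for p
  have H_lim: "(\<lambda>n. F n p) \<longlonglongrightarrow> H p" if "p \<in> P" for p
    using F_Cauchy[OF that] unfolding H_def by (simp add: Cauchy_convergent_iff convergent_LIMSEQ_iff)
  have fF_lim: "(\<lambda>n. f (F n p)) \<longlonglongrightarrow> f (H p)" if "p \<in> P" for p
    using continuous_on_tendsto_compose[OF cont_f H_lim[OF that]] by simp
  \<comment> \<open>The limit of \<open>path_length\<close> as \<open>k\<close> grows: the current
    value of \<open>f\<close> bounds the distance still to go. With \<open>n = 0\<close> this fixes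
    the zeros of \<open>f\<close>; with large \<open>n\<close> it gives continuity at time
    1.\<close>
  have H_dist: "c * dist (F n p) (H p) \<le> f (F n p)" if "p \<in> P" for n p
  proof (rule LIMSEQ_le_const2)
    show "(\<lambda>k. c * dist (F n p) (F (k + n) p)) \<longlonglongrightarrow> c * dist (F n p) (H p)"
      by (intro tendsto_intros LIMSEQ_ignore_initial_segment H_lim that)
    show "\<exists>N. \<forall>k\<ge>N. c * dist (F n p) (F (k + n) p) \<le> f (F n p)"
    proof (intro exI allI impI)
      show "c * dist (F n p) (F (k + n) p) \<le> f (F n p)" for k
        using path_length[OF that, of n k] f_nonneg[of "F (n + k) p"] by (simp add: add.commute)
    qed
  qed
  have f_H_le: "f (H p) \<le> f (fst p)" if "p \<in> P" for p
    by (rule LIMSEQ_le_const2[OF fF_lim[OF that]]) (use f_antimono[OF that, of 0] in \<open>auto simp: F_0\<close>)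

  text \<open>If the limit were not a zero of \<open>f\<close>, a field that does not vanish there would be
    applied infinitely often, each time moving the point by an amount bounded away from zero.\<close>
  have H_1: "f (H (z, 1)) = 0" if "f z < r" for z
  proof (rule ccontr)
    let ?p = "(z, 1::real)"
    have p: "?p \<in> P"
      using that by (simp add: P_def)
    assume "f (H ?p) \<noteq> 0"
    then have "H ?p \<in> W"
      using f_nonneg[of "H ?p"] f_H_le[OF p] that by (auto simp: W_def)
    then obtain v where v: "v (H ?p) \<noteq> 0" "\<And>k. \<exists>n\<ge>k. U n = v"
      using U_rec by blast
    then obtain s where s: "\<And>k. s k \<ge> k" "\<And>k. U (s k) = v"
      by metis
    have s_lim: "filterlim s sequentially sequentially"
      by (rule filterlim_at_top_mono[OF filterlim_ident]) (simp add: s)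
    have Fs: "(\<lambda>k. F (s k) ?p) \<longlonglongrightarrow> H ?p"
      by (rule filterlim_compose[OF H_lim[OF p] s_lim])
    have "(\<lambda>k. F (Suc (s k)) ?p - F (s k) ?p) \<longlonglongrightarrow> H ?p - H ?p"
      by (intro tendsto_diff Fs filterlim_compose[OF LIMSEQ_Suc[OF H_lim[OF p]] s_lim])
    \<comment> \<open>At time 1 every weight is 1, so the increment is the full push.\<close>
    moreover have "F (Suc (s k)) ?p - F (s k) ?p = v (F (s k) ?p)" for k
      by (simp add: F_Suc a_def s)
    ultimately have "(\<lambda>k. v (F (s k) ?p)) \<longlonglongrightarrow> 0"
      by simp
    moreover have "continuous_on UNIV v"
      using U_cont s(2) by metis
    then have "(\<lambda>k. v (F (s k) ?p)) \<longlonglongrightarrow> v (H ?p)"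
      by (rule continuous_on_tendsto_compose[OF _ Fs]) auto
    ultimately show False
      using v(1) LIMSEQ_unique by blast
  qed

  \<comment> \<open>The first premise says that the weight \<open>a n\<close> vanishes at time
    \<open>snd p\<close>. The weights decrease in \<open>n\<close>, so all later ones vanish too and
    the sequence is constant from stage \<open>n\<close> on.\<close>
  have H_eq_F: "H p = F n p" if "1 \<le> real (Suc n) * (1 - snd p)" "snd p \<le> 1" for n p
  proof -
    have "F (k + n) p = F n p" for k
    proof (induction k)
      case (Suc k)
      have "real (Suc n) * (1 - snd p) \<le> real (Suc (k + n)) * (1 - snd p)"
        using that(2) by (intro mult_right_mono) auto
      then have "a (k + n) (snd p) = 0"
        using that(1) by (simp add: a_def)
      with Suc show ?case
        by (simp add: F_Suc)
    qed simp
    then have "(\<lambda>k. F k p) \<longlonglongrightarrow> F n p"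
      by (auto intro: LIMSEQ_offset[of _ n])
    then show ?thesis
      unfolding H_def by (rule limI)
  qed

  \<comment> \<open>A single stage \<open>N\<close> approximates \<open>H\<close> at
    \<open>q\<close> and near \<open>q\<close>. At time 1 the reason is that
    \<open>f (F N p) < c * e\<close> is an open condition bounding the remaining distance; before
    time 1, \<open>H\<close> coincides with \<open>F N\<close> near \<open>q\<close>.\<close>
  have approx: "\<exists>N. dist (F N q) (H q) < e \<and> (\<forall>\<^sub>F p in at q within P. dist (F N p) (H p) < e)"
    if q: "q \<in> P" and "0 < e" for q e
  proof (cases "snd q = 1")
    case True
    then have "f (H q) = 0"
      using H_1[of "fst q"] q by (cases q) (auto simp: P_def)
    then have "\<forall>\<^sub>F n in sequentially. f (F n q) < c * e"
      using fF_lim[OF q] \<open>0 < c\<close> \<open>0 < e\<close> by (intro order_tendstoD(2)[where y = 0]) auto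
    then obtain N where N: "f (F N q) < c * e"
      by (meson eventually_sequentially order_refl)
    have close: "dist (F N p) (H p) < e" if "p \<in> P" "f (F N p) < c * e" for p
    proof -
      have "c * dist (F N p) (H p) < c * e"
        using H_dist[OF that(1), of N] that(2) by linarith
      then show ?thesis
        using \<open>0 < c\<close> by simp
    qed
    have "continuous_on P (\<lambda>p. f (F N p))"
      by (rule continuous_on_compose2[OF cont_f F_cont]) auto
    then have "((\<lambda>p. f (F N p)) \<longlongrightarrow> f (F N q)) (at q within P)"
      using q by (simp add: continuous_on_def)
    then have "\<forall>\<^sub>F p in at q within P. f (F N p) < c * e"
      using N by (rule order_tendstoD(2))
    moreover have "\<forall>\<^sub>F p in at q within P. p \<in> P"
      by (simp add: eventually_at_filter)
    ultimately have "\<forall>\<^sub>F p in at q within P. dist (F N p) (H p) < e"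
      by eventually_elim (rule close)
    with close[OF q N] show ?thesis
      by blast
  next
    case False
    then have "0 < 1 - snd q"
      using q by (auto simp: P_def)
    \<comment> \<open>\<open>H_eq_F\<close> needs only a weak inequality; the strict one persists
      for \<open>p\<close> near \<open>q\<close>.\<close>
    then obtain N where N: "1 < real N * (1 - snd q)"
      using ex_less_of_nat_mult by blast
    also have "\<dots> \<le> real (Suc N) * (1 - snd q)"
      using \<open>0 < 1 - snd q\<close> by (intro mult_right_mono) auto
    finally have N': "1 < real (Suc N) * (1 - snd q)" .
    have close: "dist (F N p) (H p) < e" if "p \<in> P" "1 < real (Suc N) * (1 - snd p)" for p
    proof -
      have "H p = F N p"
        using that by (intro H_eq_F) (auto simp: P_def)
      then show ?thesis
        using \<open>0 < e\<close> by simp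
    qed
    from N' have "\<forall>\<^sub>F p in at q within P. 1 < real (Suc N) * (1 - snd p)"
      by (intro order_tendstoD(1)[where y = "real (Suc N) * (1 - snd q)"] tendsto_intros)
    moreover have "\<forall>\<^sub>F p in at q within P. p \<in> P"
      by (simp add: eventually_at_filter)
    ultimately have "\<forall>\<^sub>F p in at q within P. dist (F N p) (H p) < e"
      by eventually_elim (rule close)
    with close[OF q N'] show ?thesis
      by blast
  qed
  have H_cont: "continuous_on P H"
    unfolding continuous_on_def
  proof (intro ballI tendstoI)
    fix q and e :: real assume q: "q \<in> P" and "0 < e"
    then obtain N where N: "dist (F N q) (H q) < e / 3"
      and near: "\<forall>\<^sub>F p in at q within P. dist (F N p) (H p) < e / 3"
      using approx[of q "e / 3"] by auto
    have "\<forall>\<^sub>F p in at q within P. dist (F N p) (F N q) < e / 3"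
      using F_cont[of N] q \<open>0 < e\<close> by (intro tendstoD) (auto simp: continuous_on_def)
    with near show "\<forall>\<^sub>F p in at q within P. dist (H p) (H q) < e"
    proof eventually_elim
      case (elim p)
      with N show ?case
        by metric
    qed
  qed

  have H_fix: "H (z, t) = z" if "f z = 0" "t \<in> {0..1}" for z t
  proof -
    have p: "(z, t) \<in> P"
      using that \<open>0 < r\<close> by (simp add: P_def)
    have "c * dist z (H (z, t)) \<le> 0"
      using H_dist[OF p, of 0] that(1) by (simp add: F_0)
    then show ?thesis
      using \<open>0 < c\<close> by (simp add: mult_le_0_iff)
  qed
  \<comment> \<open>Thanks to \<open>Suc n\<close> in the definition of \<open>a\<close>, already
    the weight of index 0 vanishes at time 0.\<close>
  have H_0: "H (z, 0) = z" for z
    using H_eq_F[of 0 "(z, 0)"] by (simp add: F_0)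
  show ?thesis
    unfolding deformation_retracts_to_def
  proof (intro conjI exI[of _ H])
    show "H ` ({z. f z < r} \<times> {0..1}) \<subseteq> {z. f z < r}"
      using f_H_le by (fastforce simp: P_def)
  qed (use H_cont H_0 H_1 H_fix \<open>0 < r\<close> in \<open>auto simp: P_def\<close>)
qed

section \<open>From deformation retraction to homotopy equivalence\<close>

text \<open>The end map of \<open>H\<close> is a retraction, and \<open>H\<close> joins it to the
  identity. The coordinates are swapped because library homotopies take time first.\<close>

lemma deformation_retracts_to_imp_homotopy_eqv:
  fixes X :: "'a::euclidean_space set"
  assumes "X deformation_retracts_to A"
  shows "X homotopy_eqv A"
proof -
  obtain H where AX: "A \<subseteq> X" and cont: "continuous_on (X \<times> {0..1::real}) H"
    and sub: "H ` (X \<times> {0..1}) \<subseteq> X"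
    and ends: "\<And>x. x \<in> X \<Longrightarrow> H (x, 0) = x \<and> H (x, 1) \<in> A"
    and fixed: "\<And>x t. x \<in> A \<Longrightarrow> t \<in> {0..1} \<Longrightarrow> H (x, t) = x"
    using assms unfolding deformation_retracts_to_def by metis
  let ?h = "\<lambda>x. H (x, 1)"
  have "continuous_on ({0..1} \<times> X) (\<lambda>p. H (prod.swap p))"
    by (rule continuous_on_compose2[OF cont continuous_on_swap]) auto
  moreover have "(\<lambda>p. H (prod.swap p)) \<in> {0..1} \<times> X \<rightarrow> X"
    using sub by auto
  ultimately have "continuous_map (prod_topology (top_of_set {0..1}) (top_of_set X)) (top_of_set X)
      (\<lambda>p. H (prod.swap p))"
    by (simp add: continuous_map_in_subtopology image_subset_iff_funcset)
  then have "homotopic_with_canon (\<lambda>x. True) X X id ?h"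
    using ends by (subst homotopic_with) (auto intro!: exI[of _ "\<lambda>p. H (prod.swap p)"])
  moreover have "retraction X A ?h"
    unfolding retraction_def
    using AX ends fixed by (auto intro!: continuous_on_compose2[OF cont] continuous_intros)
  ultimately show ?thesis
    by (rule deformation_retract_imp_homotopy_eqv)
qed

section \<open>Smallest enclosing balls and the generalized gradient\<close>

text \<open>For points \<open>y\<close> of a sphere around \<open>x\<close>, the squared distance to a fixed point \<open>c'\<close>
  is affine in \<open>y\<close>, so bounds on it pass from \<open>S\<close> to its convex hull.\<close>
lemma enclosing_center_cospherical:
  fixes x :: "'a::euclidean_space"
  assumes "compact S" and "S \<noteq> {}" and "S \<subseteq> sphere x \<rho>"
  shows "enclosing_center S = closest_point (convex hull S) x"
proof -
  define p where "p = closest_point (convex hull S) x"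
  have hull: "convex (convex hull S)" "closed (convex hull S)" "convex hull S \<noteq> {}"
    using assms by (auto simp: compact_imp_closed compact_convex_hull)
  have p_in: "p \<in> convex hull S"
    unfolding p_def using hull by (intro closest_point_in_set)
  have norm_y: "norm (y - x) = \<rho>" if "y \<in> S" for y
    using assms(3) that by (auto simp: dist_norm norm_minus_commute)
  \<comment> \<open>By Pythagoras, for \<open>p \<noteq> x\<close> this is the radius of the section
    of the sphere by the hyperplane through \<open>p\<close> orthogonal to
    \<open>x - p\<close>.\<close>
  define R where "R = sqrt (\<rho>\<^sup>2 - (norm (x - p))\<^sup>2)"
  obtain y0 where "y0 \<in> S"
    using assms(2) by blast
  have "norm (x - p) \<le> \<rho>"
    using closest_point_le[OF hull(2) hull_inc[OF \<open>y0 \<in> S\<close>], of x] norm_y[OF \<open>y0 \<in> S\<close>]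
    by (simp add: p_def dist_norm norm_minus_commute)
  then have R: "0 \<le> R" "R\<^sup>2 = \<rho>\<^sup>2 - (norm (x - p))\<^sup>2"
    by (auto simp: R_def power_mono)
  have "dist p y \<le> R" if "y \<in> S" for y
  proof -
    have "(x - p) \<bullet> (y - p) \<le> 0"
      unfolding p_def using hull that by (intro closest_point_dot) (auto simp: hull_inc)
    moreover have "\<rho>\<^sup>2 = (norm (y - p))\<^sup>2 + (norm (x - p))\<^sup>2 - 2 * ((x - p) \<bullet> (y - p))"
      unfolding norm_y[OF that, symmetric] power2_norm_eq_inner
      by (simp add: algebra_simps inner_commute)
    ultimately have "(dist p y)\<^sup>2 \<le> R\<^sup>2"
      unfolding R(2) by (simp add: dist_norm norm_minus_commute)
    then show ?thesis
      using R(1) by (rule power2_le_imp_le)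
  qed
  then have enclosing: "S \<subseteq> cball p R"
    by auto
  \<comment> \<open>The extra term \<open>(norm (p - c'))\<^sup>2\<close> serves uniqueness: a
    competing ball of radius \<open>R\<close> must have center \<open>p\<close>. Dropping it gives
    minimality of \<open>R\<close>.\<close>
  have lower: "R\<^sup>2 + (norm (p - c'))\<^sup>2 \<le> \<rho>'\<^sup>2" if "S \<subseteq> cball c' \<rho>'" "0 \<le> \<rho>'" for c' \<rho>'
  proof -
    \<comment> \<open>On the sphere of radius \<rho> around \<open>x\<close>, this half-space is
      exactly the condition \<open>dist c' y \<le> \<rho>'\<close>, solved for its linear
      term.\<close>
    define h where "h = {y. (x - c') \<bullet> y \<le> (\<rho>'\<^sup>2 - \<rho>\<^sup>2 - (norm (x - c'))\<^sup>2) / 2 + (x - c') \<bullet> x}"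
    have "y \<in> h" if "y \<in> S" for y
    proof -
      have "(norm (y - c'))\<^sup>2 \<le> \<rho>'\<^sup>2"
        using \<open>S \<subseteq> cball c' \<rho>'\<close> that
        by (intro power_mono) (auto simp: dist_norm norm_minus_commute)
      moreover have "(norm (y - c'))\<^sup>2 = \<rho>\<^sup>2 + (norm (x - c'))\<^sup>2 + 2 * ((x - c') \<bullet> (y - x))"
        unfolding norm_y[OF that, symmetric] power2_norm_eq_inner
        by (simp add: algebra_simps inner_commute)
      ultimately show ?thesis
        by (simp add: h_def inner_diff_right field_simps)
    qed
    moreover have "convex h"
      unfolding h_def by (rule convex_halfspace_le)
    ultimately have "p \<in> h"
      using hull_minimal[of S h convex] p_in by blast
    moreover have "(norm (p - c'))\<^sup>2 = (norm (x - p))\<^sup>2 + (norm (x - c'))\<^sup>2 + 2 * ((x - c') \<bullet> (p - x))"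
      unfolding power2_norm_eq_inner by (simp add: algebra_simps inner_commute)
    ultimately show ?thesis
      unfolding R(2) by (simp add: h_def inner_diff_right field_simps)
  qed
  have smallest: "is_smallest_enclosing_ball S p R"
    unfolding is_smallest_enclosing_ball_def
  proof (intro conjI allI impI)
    fix c' \<rho>' assume *: "0 \<le> \<rho>' \<and> S \<subseteq> cball c' \<rho>'"
    have "R\<^sup>2 \<le> \<rho>'\<^sup>2"
      using lower[of c' \<rho>'] * zero_le_power2[of "norm (p - c')"] by linarith
    then show "R \<le> \<rho>'"
      by (rule power2_le_imp_le) (use * in blast)
  qed (use R enclosing in auto)
  show ?thesis
    unfolding enclosing_center_def p_def[symmetric]
  proof (rule the_equality)
    show "\<exists>\<rho>. is_smallest_enclosing_ball S p \<rho>"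
      using smallest by blast
    fix c' assume "\<exists>\<rho>. is_smallest_enclosing_ball S c' \<rho>"
    then obtain \<rho>' where \<rho>': "is_smallest_enclosing_ball S c' \<rho>'"
      by blast
    then have "\<rho>' = R"
      using smallest unfolding is_smallest_enclosing_ball_def by (meson order_antisym)
    with lower[of c' \<rho>'] \<rho>' have "(norm (p - c'))\<^sup>2 \<le> 0"
      unfolding is_smallest_enclosing_ball_def by simp
    then show "c' = p"
      by simp
  qed
qed

lemma compact_closest_points:
  assumes "closed X"
  shows "compact (closest_points X x)"
proof -
  have "closest_points X x = X \<inter> sphere x (infdist x X)"
    by (auto simp: closest_points_def)
  then show ?thesis
    using closed_Int_compact[OF assms compact_sphere] by metis
qed

lemma closest_points_nonempty:
  assumes "closed X" and "X \<noteq> {}"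
  shows "closest_points X x \<noteq> {}"
proof -
  obtain y where "y \<in> X" "infdist x X = dist x y"
    using infdist_attains_inf[OF assms] by blast
  then show ?thesis
    by (auto simp: closest_points_def)
qed

text \<open>Take \<open>v\<close> opposite to the gradient, pointing from \<open>x\<close> to the
  nearest hull point \<open>p\<close>. The hull lies beyond the hyperplane through \<open>p\<close>
  orthogonal to \<open>x - p\<close>, so each closest point is at least \<open>norm (x - p)\<close>
  away from \<open>x\<close> in direction \<open>v\<close>.\<close>

lemma gen_gradient_direction:
  fixes X :: "'a::euclidean_space set"
  assumes "closed X" and "X \<noteq> {}" and "x \<notin> X" and "0 < \<mu>" and "\<mu> \<le> norm (gen_gradient X x)"
  obtains v where "norm v = 1"
    and "\<And>y. y \<in> closest_points X x \<Longrightarrow> (x - y) \<bullet> v \<le> - \<mu> * infdist x X"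
proof -
  let ?K = "convex hull (closest_points X x)"
  define p where "p = closest_point ?K x"
  have K: "closed ?K"
    using assms by (simp add: compact_closest_points compact_convex_hull compact_imp_closed)
  have center: "enclosing_center (closest_points X x) = p"
    unfolding p_def
    by (rule enclosing_center_cospherical[where \<rho> = "infdist x X"])
      (use assms compact_closest_points closest_points_nonempty in \<open>auto simp: closest_points_def\<close>)
  have d: "0 < infdist x X"
    using assms by (simp add: infdist_pos_not_in_closed)
  have "\<mu> \<le> norm (x - p) / infdist x X"
    using assms(5) d by (simp add: gen_gradient_def center divide_inverse mult.commute)
  then have le: "\<mu> * infdist x X \<le> norm (x - p)"
    using d by (simp add: field_simps)
  then have pos: "0 < norm (x - p)"
    using d \<open>0 < \<mu>\<close> by (smt (verit) mult_pos_pos)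
  show ?thesis
  proof
    show "norm ((p - x) /\<^sub>R norm (x - p)) = 1"
      using pos by (simp add: norm_minus_commute)
    fix y assume "y \<in> closest_points X x"
    then have "(x - p) \<bullet> (y - p) \<le> 0"
      unfolding p_def using K by (intro closest_point_dot) (auto simp: hull_inc)
    moreover have "(x - y) \<bullet> (p - x) = (x - p) \<bullet> (y - p) - (norm (x - p))\<^sup>2"
      unfolding power2_norm_eq_inner by (simp add: algebra_simps inner_commute)
    ultimately have "(x - y) \<bullet> (p - x) \<le> - (norm (x - p) * norm (x - p))"
      by (simp add: power2_eq_square)
    then have "(x - y) \<bullet> ((p - x) /\<^sub>R norm (x - p)) \<le> - norm (x - p)"
      using pos by (simp only: inner_scaleR_right) (simp add: field_simps)
    then show "(x - y) \<bullet> ((p - x) /\<^sub>R norm (x - p)) \<le> - \<mu> * infdist x X"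
      using le by simp
  qed
qed

section \<open>Local descent of the distance function\<close>

text \<open>The rate \<mu> at \<open>x\<close> drops to 3/4 \<mu> when the base point is perturbed,
  and to \<mu>/2 after absorbing the quadratic term of a step of positive length.\<close>

lemma infdist_local_descent:
  fixes X :: "'a::euclidean_space set"
  assumes "closed X" and "X \<noteq> {}" and "x \<notin> X" and "0 < \<mu>" and "\<mu> \<le> 1" and "norm v = 1"
    and dir: "\<And>y. y \<in> closest_points X x \<Longrightarrow> (x - y) \<bullet> v \<le> - \<mu> * infdist x X"
  obtains \<epsilon> where "0 < \<epsilon>"
    and "\<And>z t. z \<in> ball x \<epsilon> \<Longrightarrow> t \<in> {0..\<epsilon>} \<Longrightarrow>
      infdist (z + t *\<^sub>R v) X \<le> infdist z X - \<mu> / 2 * t"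
proof -
  have d: "0 < infdist x X"
    using assms by (simp add: infdist_pos_not_in_closed)
  \<comment> \<open>Semicontinuity of the closest points: counterexamples \<open>z n\<close> tending
    to \<open>x\<close> would have closest points subconverging to a closest point \<open>w\<close>
    of \<open>x\<close>, where the rate is \<mu> and not just 3/4 \<mu>.\<close>
  have "\<exists>\<delta>>0. \<forall>z\<in>ball x \<delta>. \<forall>y\<in>closest_points X z. (z - y) \<bullet> v \<le> - (3 / 4 * \<mu>) * infdist z X"
  proof (rule ccontr)
    assume "\<not> ?thesis"
    then have "\<forall>n. \<exists>z y. z \<in> ball x (inverse (real (Suc n))) \<and> y \<in> closest_points X z \<and>
        \<not> (z - y) \<bullet> v \<le> - (3 / 4 * \<mu>) * infdist z X"
      by (metis inverse_positive_iff_positive of_nat_0_less_iff zero_less_Suc)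
    then obtain z y where z: "\<And>n. dist x (z n) < inverse (real (Suc n))"
      and y: "\<And>n. y n \<in> closest_points X (z n)"
      and gt: "\<And>n. (z n - y n) \<bullet> v > - (3 / 4 * \<mu>) * infdist (z n) X"
      by (metis mem_ball not_le)
    have "(\<lambda>n. dist (z n) x) \<longlonglongrightarrow> 0"
      by (rule tendsto_sandwich[OF _ _ tendsto_const LIMSEQ_inverse_real_of_nat])
        (use z in \<open>auto simp: dist_commute less_imp_le\<close>)
    then have z_lim: "z \<longlonglongrightarrow> x"
      by (rule tendsto_dist_iff[THEN iffD2])
    have y_X: "y n \<in> X" and y_dist: "dist (z n) (y n) = infdist (z n) X" for n
      using y by (auto simp: closest_points_def)
    have "bounded (range z)"
      using z_lim by (rule convergent_imp_bounded)
    have "bounded (range (\<lambda>n. z n - y n))"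
    proof -
      have "(\<lambda>n. infdist (z n) X) \<longlonglongrightarrow> infdist x X"
        using z_lim by (intro tendsto_intros)
      then have "bounded (range (\<lambda>n. infdist (z n) X))"
        by (rule convergent_imp_bounded)
      then show ?thesis
        by (simp add: bounded_iff y_dist[symmetric] dist_norm)
    qed
    then have "bounded (range (\<lambda>n. z n - (z n - y n)))"
      using \<open>bounded (range z)\<close> by (rule bounded_minus_comp[rotated])
    then have "bounded (range y)"
      by simp
    then obtain w s where s: "strict_mono s" "(y \<circ> s) \<longlonglongrightarrow> w"
      using bounded_imp_convergent_subsequence by blast
    have zs: "(\<lambda>n. z (s n)) \<longlonglongrightarrow> x" and ys: "(\<lambda>n. y (s n)) \<longlonglongrightarrow> w"
      using LIMSEQ_subseq_LIMSEQ[OF z_lim s(1)] s(2) by (simp_all add: o_def)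
    have ds: "(\<lambda>n. infdist (z (s n)) X) \<longlonglongrightarrow> infdist x X"
      using zs by (intro tendsto_intros)
    have "w \<in> X"
      using closed_sequentially[OF \<open>closed X\<close> _ ys] y_X by blast
    moreover have "dist x w = infdist x X"
      using tendsto_dist[OF zs ys] ds unfolding y_dist by (rule LIMSEQ_unique)
    ultimately have "(x - w) \<bullet> v \<le> - \<mu> * infdist x X"
      by (intro dir) (simp add: closest_points_def)
    moreover have "- (3 / 4 * \<mu>) * infdist x X \<le> (x - w) \<bullet> v"
      by (rule LIMSEQ_le[of "\<lambda>n. - (3 / 4 * \<mu>) * infdist (z (s n)) X" _ "\<lambda>n. (z (s n) - y (s n)) \<bullet> v"])
        (use gt in \<open>auto intro!: tendsto_intros zs ys ds less_imp_le\<close>)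
    moreover have "0 < \<mu> * infdist x X"
      using d \<open>0 < \<mu>\<close> by simp
    ultimately show False
      by simp
  qed
  then obtain \<delta> where "0 < \<delta>" and \<delta>: "\<And>z y. z \<in> ball x \<delta> \<Longrightarrow> y \<in> closest_points X z \<Longrightarrow>
      (z - y) \<bullet> v \<le> - (3 / 4 * \<mu>) * infdist z X"
    by blast
  \<comment> \<open>The second bound keeps \<open>infdist z X\<close> above half of
    \<open>infdist x X\<close> on the ball, whence \<open>t \<le> \<mu> / 2 * D\<close>; this
    absorbs \<open>t * t\<close> below.\<close>
  define \<epsilon> where "\<epsilon> = min \<delta> (\<mu> / 4 * infdist x X)"
  show ?thesis
  proof
    show "0 < \<epsilon>"
      using \<open>0 < \<delta>\<close> d \<open>0 < \<mu>\<close> by (simp add: \<epsilon>_def)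
    fix z t assume z: "z \<in> ball x \<epsilon>" and t: "t \<in> {0..\<epsilon>}"
    define D where "D = infdist z X"
    obtain y where y: "y \<in> closest_points X z"
      using closest_points_nonempty[OF assms(1,2)] by blast
    then have yX: "y \<in> X" and y_dist: "norm (z - y) = D"
      by (auto simp: closest_points_def D_def dist_norm)
    have "\<epsilon> \<le> \<mu> / 4 * infdist x X"
      by (simp add: \<epsilon>_def)
    also have "\<dots> \<le> 1 / 4 * infdist x X"
      using \<open>\<mu> \<le> 1\<close> d by (intro mult_right_mono) auto
    finally have "\<epsilon> \<le> infdist x X / 4"
      by simp
    moreover have "infdist x X \<le> D + dist x z"
      unfolding D_def by (rule infdist_triangle)
    ultimately have D_ge: "infdist x X / 2 \<le> D"
      using z d by simp
    have "t \<le> \<mu> / 4 * infdist x X"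
      using t by (simp add: \<epsilon>_def)
    also have "\<dots> \<le> \<mu> / 2 * D"
      using mult_left_mono[OF D_ge, of "\<mu> / 2"] \<open>0 < \<mu>\<close> by simp
    finally have t_le: "t \<le> \<mu> / 2 * D" .
    have "(z - y) \<bullet> v \<le> - (3 / 4 * \<mu>) * D"
      unfolding D_def using z by (intro \<delta> y) (simp add: \<epsilon>_def)
    then have "2 * t * ((z - y) \<bullet> v) \<le> 2 * t * (- (3 / 4 * \<mu>) * D)"
      using t by (intro mult_left_mono) auto
    moreover have "t * t \<le> t * (\<mu> / 2 * D)"
      using t t_le by (intro mult_left_mono) auto
    moreover have "(norm (z + t *\<^sub>R v - y))\<^sup>2 = D\<^sup>2 + 2 * t * ((z - y) \<bullet> v) + t * t"
    proof -
      have "v \<bullet> v = 1"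
        using \<open>norm v = 1\<close> by (simp add: norm_eq_1)
      then show ?thesis
        unfolding y_dist[symmetric] power2_norm_eq_inner
        by (simp add: algebra_simps inner_commute)
    qed
    ultimately have "(norm (z + t *\<^sub>R v - y))\<^sup>2 \<le> D\<^sup>2 - \<mu> * D * t"
      by (simp add: algebra_simps)
    \<comment> \<open>Completing the square adds \<open>(\<mu> / 2 * t)\<^sup>2\<close>.\<close>
    also have "\<dots> \<le> (D - \<mu> / 2 * t)\<^sup>2"
      by (simp add: power2_diff algebra_simps)
    finally have "norm (z + t *\<^sub>R v - y) \<le> D - \<mu> / 2 * t"
    proof (rule power2_le_imp_le)
      have "\<mu> / 2 * t \<le> 1 * t"
        using \<open>\<mu> \<le> 1\<close> t by (intro mult_right_mono) auto
      also have "\<dots> \<le> 1 * D"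
        using t_le mult_right_mono[of "\<mu> / 2" 1 D] \<open>\<mu> \<le> 1\<close> D_ge d by linarith
      finally show "0 \<le> D - \<mu> / 2 * t"
        by simp
    qed
    then show "infdist (z + t *\<^sub>R v) X \<le> infdist z X - \<mu> / 2 * t"
      using infdist_le[OF yX, of "z + t *\<^sub>R v"] by (simp add: D_def dist_norm)
  qed
qed

lemma descent_field_infdist:
  fixes X :: "'a::euclidean_space set"
  assumes "closed X" and "X \<noteq> {}" and "x \<notin> X" and "0 < \<mu>" and "\<mu> \<le> 1"
    and "\<mu> \<le> norm (gen_gradient X x)"
  obtains u where "descent_field (\<lambda>z. infdist z X) (\<mu> / 2) u" and "u x \<noteq> 0"
proof -
  obtain v where v: "norm v = 1"
    and "\<And>y. y \<in> closest_points X x \<Longrightarrow> (x - y) \<bullet> v \<le> - \<mu> * infdist x X"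
    using gen_gradient_direction[OF assms(1-4,6)] by blast
  then obtain \<epsilon> where "0 < \<epsilon>" and \<epsilon>: "\<And>z t. z \<in> ball x \<epsilon> \<Longrightarrow> t \<in> {0..\<epsilon>} \<Longrightarrow>
      infdist (z + t *\<^sub>R v) X \<le> infdist z X - \<mu> / 2 * t"
    using infdist_local_descent[OF assms(1-5)] by blast
  \<comment> \<open>A continuous cutoff of the constant direction: it vanishes off the ball, and its
    length is at most \<epsilon>, the range of steps allowed by the local estimate.\<close>
  define u where "u z = max 0 (\<epsilon> - dist x z) *\<^sub>R v" for z
  have "infdist (z + t *\<^sub>R u z) X \<le> infdist z X - \<mu> / 2 * (t * norm (u z))" if "t \<in> {0..1}" for z t
  proof (cases "z \<in> ball x \<epsilon>")
    case True
    have "t * (\<epsilon> - dist x z) \<le> 1 * \<epsilon>"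
      using True that by (intro mult_mono) auto
    with True that \<epsilon>[OF True, of "t * (\<epsilon> - dist x z)"] show ?thesis
      by (simp add: u_def v)
  qed (simp add: u_def)
  then have "descent_field (\<lambda>z. infdist z X) (\<mu> / 2) u"
    unfolding descent_field_def u_def by (auto intro!: continuous_intros)
  moreover have "u x \<noteq> 0"
    using \<open>0 < \<epsilon>\<close> v by (auto simp: u_def)
  ultimately show ?thesis ..
qed

section \<open>The reach and the offsets\<close>

text \<open>A closest point \<open>q\<close> of \<open>x\<close> makes \<open>infdist x X\<close>
  one of the values over which the infimum is taken.\<close>

lemma mu_reach_le_infdist:
  assumes "closed X" and "X \<noteq> {}" and "x \<in> mu_medial_axis \<mu> X"
  shows "mu_reach \<mu> X \<le> ereal (infdist x X)"
proof -
  obtain q where "q \<in> X" "infdist x X = norm (q - x)"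
    using infdist_attains_inf[OF assms(1,2), of x] by (metis dist_norm norm_minus_commute)
  then show ?thesis
    unfolding mu_reach_def using assms(3) by (auto intro!: Inf_lower)
qed

theorem theorem12:
  fixes X :: "'a::euclidean_space set" and \<mu> :: real
  assumes "0 < \<mu>" and "\<mu> \<le> 1"
    and "closed X" and "X \<noteq> {}"
    and "0 < mu_reach \<mu> X"
  shows "\<forall>r::real. 0 < r \<and> ereal r \<le> mu_reach \<mu> X \<longrightarrow>
    offset X r deformation_retracts_to X \<and> X homotopy_eqv offset X r"
proof (intro allI impI)
  fix r :: real assume r: "0 < r \<and> ereal r \<le> mu_reach \<mu> X"
  have zero_set: "{z. infdist z X = 0} = X"
    using in_closed_iff_infdist_zero[OF assms(3,4)] by blast
  have "{z. infdist z X < r} deformation_retracts_to {z. infdist z X = 0}"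
  proof (rule deformation_retracts_to_zero_set[where c = "\<mu> / 2"])
    fix x assume x: "0 < infdist x X" "infdist x X < r"
    have "x \<notin> X"
      using x(1) by auto
    \<comment> \<open>The strict inequality defining the offset is what admits \<open>r\<close>
      equal to the reach.\<close>
    moreover have "x \<notin> mu_medial_axis \<mu> X"
    proof
      assume "x \<in> mu_medial_axis \<mu> X"
      from mu_reach_le_infdist[OF assms(3,4) this] r have "ereal r \<le> ereal (infdist x X)"
        using order_trans by blast
      then show False
        using x(2) by simp
    qed
    ultimately have "\<mu> \<le> norm (gen_gradient X x)"
      by (simp add: mu_medial_axis_def)
    then show "\<exists>u. descent_field (\<lambda>z. infdist z X) (\<mu> / 2) u \<and> u x \<noteq> 0"
      using descent_field_infdist[OF assms(3,4) \<open>x \<notin> X\<close> assms(1,2)] by blast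
  qed (use assms r in \<open>auto intro!: continuous_intros infdist_nonneg\<close>)
  then have "offset X r deformation_retracts_to X"
    by (simp add: offset_def zero_set)
  then show "offset X r deformation_retracts_to X \<and> X homotopy_eqv offset X r"
    using deformation_retracts_to_imp_homotopy_eqv homotopy_equivalent_space_sym by blast
qed

end
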